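(* Let $X,Y$ be topological spaces. If $X$ and $Y$ are homotopy equivalent, then $\mathrm{cat}(X)=\mathrm{cat}(Y)$.
   Context: A continuous map is null-homotopic if it is (freely) homotopic to a constant map. The LS category $\mathrm{cat}(X)$ of a space $X$ is the least positive integer $k$ such that $X$ is a union of open subsets $U_1,\dots,U_k$ with each inclusion $U_j\hookrightarrow X$ null-homotopic, and $\infty$ if no such integer exists. *)

theory Defs
  imports "HOL-Analysis.Analysis"
begin

(* The homotopy is free. If topspace X is nonempty, the homotopy itself forces c to lie in
   topspace Y. If topspace X is empty, every map counts as constant, also when topspace Y
   is empty (the convention of contractible_space). *)
definition null_homotopic_map :: "'a topology \<Rightarrow> 'b topology \<Rightarrow> ('a \<Rightarrow> 'b) \<Rightarrow> bool" where
  "null_homotopic_map X Y f \<longleftrightarrow>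
     continuous_map X Y f \<and> (\<exists>c. homotopic_with (\<lambda>_. True) X Y f (\<lambda>_. c))"

(* The infimum of the empty set in enat is \<infinity>; the infimum of a nonempty set is its least
   element. The sets U j may be empty or coincide, and no base point or separation axiom is
   involved. The value is not shifted by one: contractible spaces have category 1. *)
definition LS_cat :: "'a topology \<Rightarrow> enat" where
  "LS_cat X = Inf {enat k | k. k \<ge> 1 \<and>
     (\<exists>U. (\<forall>j\<in>{1..k}. openin X (U j) \<and> null_homotopic_map (subtopology X (U j)) X id)
          \<and> (\<Union>j\<in>{1..k}. U j) = topspace X)}"

end

theory Submission
  imports Defs
begin

text \<open>
  If \<open>f \<circ> g\<close> is homotopic to the identity of \<open>Y\<close> and \<open>U\<close> is an open subset of \<open>X\<close> with
  null-homotopic inclusion, then the inclusion of the preimage of \<open>U\<close> under \<open>g\<close> is homotopic to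
  \<open>f \<circ> g\<close>, which factors through the inclusion of \<open>U\<close> and is hence null-homotopic. So a
  categorical cover of \<open>X\<close> pulls back along \<open>g\<close> to a categorical cover of \<open>Y\<close> of the same size.
\<close>

lemma null_homotopic_map_compose:
  assumes "null_homotopic_map X Y f" "continuous_map W X g" "continuous_map Y Z h"
  shows "null_homotopic_map W Z (h \<circ> f \<circ> g)"
proof -
  obtain c where f: "continuous_map X Y f"
    and c: "homotopic_with (\<lambda>_. True) X Y f (\<lambda>_. c)"
    using assms(1) unfolding null_homotopic_map_def by blast
  have "homotopic_with (\<lambda>_. True) W Z (h \<circ> f \<circ> g) (h \<circ> (\<lambda>_. c) \<circ> g)"
    by (rule homotopic_with_compose_continuous_map_right[where p = "\<lambda>_. True",
        OF homotopic_with_compose_continuous_map_left[where p = "\<lambda>_. True",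
          OF c assms(3)] assms(2)]) auto
  moreover have "h \<circ> (\<lambda>_. c) \<circ> g = (\<lambda>_. h c)"
    by auto
  ultimately show ?thesis
    using homotopic_with_imp_continuous_maps unfolding null_homotopic_map_def by metis
qed

lemma null_homotopic_map_homotopic:
  assumes "null_homotopic_map X Y f" "homotopic_with (\<lambda>_. True) X Y f g"
  shows "null_homotopic_map X Y g"
  using assms unfolding null_homotopic_map_def
  by (meson homotopic_with_imp_continuous_maps homotopic_with_symD homotopic_with_trans)

lemma null_homotopic_inclusion_vimage:
  assumes f: "continuous_map X Y f" and g: "continuous_map Y X g"
    and fg: "homotopic_with (\<lambda>_. True) Y Y (f \<circ> g) id"
    and U: "null_homotopic_map (subtopology X U) X id"
  shows "null_homotopic_map (subtopology Y {y \<in> topspace Y. g y \<in> U}) Y id"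
proof (rule null_homotopic_map_homotopic)
  let ?V = "{y \<in> topspace Y. g y \<in> U}"
  \<comment> \<open>Corestricting \<open>g\<close> to \<open>U\<close> exhibits
    \<open>f \<circ> g\<close> on \<open>?V\<close> as \<open>f \<circ> id \<circ> g\<close>, with
    the null-homotopic inclusion of \<open>U\<close> in the middle.\<close>
  have "continuous_map (subtopology Y ?V) (subtopology X U) g"
    using g by (auto simp: continuous_map_in_subtopology continuous_map_from_subtopology)
  from null_homotopic_map_compose[OF U this f]
  show "null_homotopic_map (subtopology Y ?V) Y (f \<circ> g)"
    by simp
  \<comment> \<open>Precomposing with \<open>id\<close>, seen as the inclusion of \<open>?V\<close>,
    restricts the homotopy \<open>fg\<close>.\<close>
  show "homotopic_with (\<lambda>_. True) (subtopology Y ?V) Y (f \<circ> g) id"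
    using homotopic_with_compose_continuous_map_right[OF fg, of "subtopology Y ?V" id "\<lambda>_. True"]
    by (simp add: continuous_map_from_subtopology)
qed

text \<open>Homotopy domination of \<open>Y\<close> by \<open>X\<close> suffices for this
  inequality.\<close>

lemma LS_cat_le_of_homotopy_right_inverse:
  assumes f: "continuous_map X Y f" and g: "continuous_map Y X g"
    and fg: "homotopic_with (\<lambda>_. True) Y Y (f \<circ> g) id"
  shows "LS_cat Y \<le> LS_cat X"
  unfolding LS_cat_def
\<comment> \<open>Every \<open>k\<close> admissible for \<open>X\<close> is admissible for
  \<open>Y\<close>; comparing infima also settles infinite values.\<close>
proof (rule Inf_superset_mono, clarify)
  fix k :: nat and U
  assume k: "1 \<le> k"
    and U: "\<forall>j\<in>{1..k}. openin X (U j) \<and> null_homotopic_map (subtopology X (U j)) X id"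
    and cover: "(\<Union>j\<in>{1..k}. U j) = topspace X"
  define V where "V j = {y \<in> topspace Y. g y \<in> U j}" for j
  have "\<forall>j\<in>{1..k}. openin Y (V j) \<and> null_homotopic_map (subtopology Y (V j)) Y id"
    using U null_homotopic_inclusion_vimage[OF f g fg] openin_continuous_map_preimage[OF g]
    unfolding V_def by blast
  moreover have "(\<Union>j\<in>{1..k}. V j) = topspace Y"
    using cover continuous_map_image_subset_topspace[OF g] unfolding V_def by blast
  ultimately show "\<exists>k'. enat k = enat k' \<and> 1 \<le> k' \<and>
     (\<exists>U. (\<forall>j\<in>{1..k'}. openin Y (U j) \<and> null_homotopic_map (subtopology Y (U j)) Y id)
          \<and> (\<Union>j\<in>{1..k'}. U j) = topspace Y)"
    using k by blast
qed

theorem mainTheorem17: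
  fixes X :: "'a topology" and Y :: "'b topology"
  assumes "X homotopy_equivalent_space Y"
  shows "LS_cat X = LS_cat Y"
proof -
  obtain f g where "continuous_map X Y f" "continuous_map Y X g"
    and "homotopic_with (\<lambda>_. True) X X (g \<circ> f) id"
    and "homotopic_with (\<lambda>_. True) Y Y (f \<circ> g) id"
    using assms unfolding homotopy_equivalent_space_def by blast
  then show ?thesis
    \<comment> \<open>Each of the two homotopies gives one inequality, with \<open>f\<close> and
      \<open>g\<close> swapping roles.\<close>
    by (intro order_antisym LS_cat_le_of_homotopy_right_inverse)
qed

end
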